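(* Let $\mathbb{O}=\{W\lambda \mid \lambda\in P\}$ be the set of $W$-orbits in $P$. A $W$-orbit $O\in\mathbb{O}$ satisfies $O\cap(P^+\cup -P^+)=\emptyset$ if and only if $O$ contains an integral weight of the form either (i) or (ii): (i) $k\Lambda_1-l\Lambda_2$ for some $k,l\in\mathbb{Z}_{>0}$ such that $l\le k<(a-1)l$; (ii) $k\Lambda_1-l\Lambda_2$ for some $k,l\in\mathbb{Z}_{>0}$ such that $k<l\le (b-1)k$.
   Context: Let $a,b\in\mathbb{Z}_{\ge 2}$ with $ab>4$, let $A=\begin{pmatrix}2&-a\\-b&2\end{pmatrix}$, and let $\mathfrak{g}=\mathfrak{g}(A)$ be the hyperbolic Kac-Moody algebra of rank $2$ over $\mathbb{C}$ associated to $A$, with simple roots $\alpha_1,\alpha_2$, simple coroots $\alpha_1^\vee,\alpha_2^\vee$, and fundamental weights $\Lambda_1,\Lambda_2$ ($\langle\Lambda_i,\alpha_j^\vee\rangle=\delta_{i,j}$). Set $P=\mathbb{Z}\Lambda_1\oplus\mathbb{Z}\Lambda_2$; then $\alpha_1=2\Lambda_1-b\Lambda_2$ and $\alpha_2=-a\Lambda_1+2\Lambda_2$. The Weyl group $W=\langle r_1,r_2\rangle$ acts on $P$ by $r_i(\mu)=\mu-\langle\mu,\alpha_i^\vee\rangle\alpha_i$. $P^+=\mathbb{Z}_{\ge0}\Lambda_1+\mathbb{Z}_{\ge0}\Lambda_2$ is the set of dominant integral weights and $-P^+$ the set of antidominant integral weights. *)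

theory Defs
  imports "HOL-Analysis.Cartesian_Space" "HOL-Algebra.Group_Action" "HOL-Algebra.Generated_Groups"
begin

text \<open>
  The weight lattice \<open>P = \<int>\<Lambda>\<^sub>1 \<oplus> \<int>\<Lambda>\<^sub>2\<close> is the free module \<open>int ^ 2\<close>, in coordinates with respect
  to the fundamental weights. Since \<open>\<langle>\<Lambda>\<^sub>i, \<alpha>\<^sub>j\<^sup>\<or>\<rangle> = \<delta>\<^sub>i\<^sub>j\<close>, pairing with \<open>\<alpha>\<^sub>j\<^sup>\<or>\<close> is the \<open>j\<close>-th coordinate.
  In type \<open>2\<close> the indices 1 and 2 are the two distinct elements.
\<close>

type_synonym weight = "int ^ 2"

definition fundamental_weight :: "2 \<Rightarrow> weight" ("\<Lambda>") where
  "\<Lambda> i = axis i 1"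

definition coroot_pairing :: "weight \<Rightarrow> 2 \<Rightarrow> int" where
  "coroot_pairing \<mu> i = \<mu> $ i"

definition cartan_matrix :: "int \<Rightarrow> int \<Rightarrow> int ^ 2 ^ 2" where
  "cartan_matrix a b = vector [vector [2, - a], vector [- b, 2]]"

text \<open>
  With the convention \<open>\<langle>\<alpha>\<^sub>j, \<alpha>\<^sub>i\<^sup>\<or>\<rangle> = A\<^sub>i\<^sub>j\<close>, the coordinates of \<open>\<alpha>\<^sub>j\<close> form the \<open>j\<close>-th column of \<open>A\<close>.
\<close>

definition simple_root :: "int ^ 2 ^ 2 \<Rightarrow> 2 \<Rightarrow> weight" where
  "simple_root A j = (\<Sum>i\<in>UNIV. (A $ i $ j) *s \<Lambda> i)"

definition simple_reflection :: "int ^ 2 ^ 2 \<Rightarrow> 2 \<Rightarrow> weight \<Rightarrow> weight" where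
  "simple_reflection A i \<mu> = \<mu> - coroot_pairing \<mu> i *s simple_root A i"

text \<open>
  The Weyl group is realized as the group of permutations of \<open>P\<close> generated by \<open>r\<^sub>1, r\<^sub>2\<close>. For
  \<open>det A \<noteq> 0\<close> the lattice \<open>P\<close> spans the dual of the Cartan subalgebra, so the action of the Weyl group on
  \<open>P\<close> is faithful.
\<close>

definition weyl_group :: "int ^ 2 ^ 2 \<Rightarrow> (weight \<Rightarrow> weight) monoid" where
  "weyl_group A = (BijGroup UNIV)
     \<lparr>carrier := generate (BijGroup UNIV) {simple_reflection A 1, simple_reflection A 2}\<rparr>"

definition weyl_orbits :: "int ^ 2 ^ 2 \<Rightarrow> weight set set" where
  "weyl_orbits A = orbits (weyl_group A) UNIV (\<lambda>w. w)"

definition dominant_weights :: "weight set" ("P\<^sup>+") where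
  "P\<^sup>+ = {m *s \<Lambda> 1 + n *s \<Lambda> 2 | m n. m \<ge> 0 \<and> n \<ge> 0}"

definition antidominant_weights :: "weight set" ("-P\<^sup>+") where
  "-P\<^sup>+ = uminus ` P\<^sup>+"

lemma coroot_pairing_fundamental_weight:
  "coroot_pairing (\<Lambda> i) j = (if i = j then 1 else 0)"
  by (auto simp: coroot_pairing_def fundamental_weight_def axis_def)

lemma simple_root_cartan_matrix:
  "simple_root (cartan_matrix a b) 1 = 2 *s \<Lambda> 1 - b *s \<Lambda> 2"
  "simple_root (cartan_matrix a b) 2 = - a *s \<Lambda> 1 + 2 *s \<Lambda> 2"
  by (simp_all add: simple_root_def cartan_matrix_def sum_2 vec_eq_iff)

lemma coroot_pairing_simple_root:
  "coroot_pairing (simple_root A j) i = A $ i $ j"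
  using exhaust_2[of i]
  by (auto simp: coroot_pairing_def simple_root_def sum_2 fundamental_weight_def axis_def)

lemma simple_reflection_Bij:
  assumes "A $ i $ i = 2"
  shows "simple_reflection A i \<in> Bij UNIV"
proof -
  have "coroot_pairing (simple_reflection A i \<mu>) i = - coroot_pairing \<mu> i" for \<mu>
    using coroot_pairing_simple_root[of A i i] assms
    by (simp add: simple_reflection_def coroot_pairing_def)
  then have "simple_reflection A i (simple_reflection A i \<mu>) = \<mu>" for \<mu>
    by (simp add: simple_reflection_def[of A i "simple_reflection A i \<mu>"])
       (simp add: simple_reflection_def vec_eq_iff)
  then show ?thesis
    by (auto simp: Bij_def intro!: o_bij[of "simple_reflection A i"])
qed

lemma group_weyl_group: "group (weyl_group (cartan_matrix a b))"
proof -
  interpret group "BijGroup (UNIV :: weight set)"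
    by (rule group_BijGroup)
  have "{simple_reflection (cartan_matrix a b) 1, simple_reflection (cartan_matrix a b) 2}
      \<subseteq> carrier (BijGroup UNIV)"
    by (auto simp: BijGroup_def cartan_matrix_def intro!: simple_reflection_Bij)
  then show ?thesis
    unfolding weyl_group_def by (intro subgroup_imp_group generate_is_subgroup)
qed

end

theory Submission
  imports Defs
begin

text \<open>
  In coordinates \<open>r\<^sub>1 (x, y) = (-x, y + b x)\<close> and \<open>r\<^sub>2 (x, y) = (x + a y, -y)\<close>, and the quadratic form
  \<open>Q (x, y) = b x\<^sup>2 + a b x y + a y\<^sup>2\<close>, which is proportional to the invariant form on the dual of the Cartan
  subalgebra, is constant on \<open>W\<close>-orbits.

  It is nonnegative on \<open>P\<^sup>+ \<union> -P\<^sup>+\<close>, where \<open>x\<close> and \<open>y\<close> do not have opposite signs.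
  Put \<open>t = k / l\<close> for a weight \<open>\<plusminus>(k \<Lambda>\<^sub>1 - l \<Lambda>\<^sub>2)\<close> with \<open>k, l > 0\<close>. Up to a positive factor, \<open>Q\<close> is the convex
  function \<open>t\<^sup>2 - a t + a / b\<close>, which takes the same negative value \<open>(a + b - a b) / b\<close> at \<open>t = 1\<close> and
  \<open>t = a - 1\<close>; hence \<open>Q < 0\<close> in case (i), and by symmetry in case (ii). This gives one implication.

  For the other implication, an orbit \<open>O\<close> that avoids \<open>P\<^sup>+ \<union> -P\<^sup>+\<close> consists of weights \<open>\<plusminus>(k \<Lambda>\<^sub>1 - l \<Lambda>\<^sub>2)\<close> with
  \<open>k, l > 0\<close>. Up to sign, \<open>r\<^sub>2\<close> acts on them by \<open>k \<mapsto> a l - k\<close> and \<open>r\<^sub>1\<close> by \<open>l \<mapsto> b k - l\<close>; both reflections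
  exchange the two signs. A weight of \<open>O\<close> that minimizes \<open>k + l\<close> therefore has \<open>2 k \<le> a l\<close> and
  \<open>2 l \<le> b k\<close>, that is, \<open>2 / b \<le> t \<le> a / 2\<close>. Cases (i) and (ii) together say that
  \<open>1 / (b - 1) \<le> t < a - 1\<close>, with the sign \<open>+\<close>. If the minimal weight has the sign \<open>+\<close>, it is thus itself of
  form (i) or (ii), except when \<open>a = 2\<close> and \<open>t = 1\<close>; in that case \<open>r\<^sub>2\<close> maps it to its negative, which is
  also minimal. If the minimal weight has the sign \<open>-\<close>, a single reflection makes the sign \<open>+\<close> and gives a
  weight of form (i) or (ii): for \<open>t > 1\<close> take \<open>r\<^sub>2\<close>, since \<open>a / 2 \<le> a - t < a - 1\<close>; for \<open>t \<le> 1\<close> take \<open>r\<^sub>1\<close>,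
  since \<open>b / 2 \<le> b - 1 / t \<le> b - 1\<close>.
\<close>

section \<open>The Weyl group in coordinates\<close>

lemma simple_reflection_coords:
  "simple_reflection (cartan_matrix a b) 1 \<mu> $ 1 = - \<mu> $ 1"
  "simple_reflection (cartan_matrix a b) 1 \<mu> $ 2 = \<mu> $ 2 + b * \<mu> $ 1"
  "simple_reflection (cartan_matrix a b) 2 \<mu> $ 1 = \<mu> $ 1 + a * \<mu> $ 2"
  "simple_reflection (cartan_matrix a b) 2 \<mu> $ 2 = - \<mu> $ 2"
  by (simp_all add: simple_reflection_def simple_root_cartan_matrix coroot_pairing_def
      fundamental_weight_def axis_def algebra_simps)

lemma simple_reflection_involution:
  "simple_reflection (cartan_matrix a b) i (simple_reflection (cartan_matrix a b) i \<mu>) = \<mu>"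
  using exhaust_2[of i] by (auto simp: vec_eq_iff forall_2 simple_reflection_coords)

lemma simple_reflection_in_BijGroup:
  "simple_reflection (cartan_matrix a b) i \<in> carrier (BijGroup UNIV)"
  using exhaust_2[of i]
  by (auto simp: BijGroup_def cartan_matrix_def intro!: simple_reflection_Bij)

lemma inv_simple_reflection:
  "inv\<^bsub>BijGroup UNIV\<^esub> simple_reflection (cartan_matrix a b) i = simple_reflection (cartan_matrix a b) i"
proof -
  interpret group "BijGroup (UNIV :: weight set)"
    by (rule group_BijGroup)
  let ?r = "simple_reflection (cartan_matrix a b) i"
  have "?r \<otimes>\<^bsub>BijGroup UNIV\<^esub> ?r = \<one>\<^bsub>BijGroup UNIV\<^esub>"
    using simple_reflection_in_BijGroup[of a b i]
    by (auto simp: BijGroup_def compose_def fun_eq_iff simple_reflection_involution)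
  then show ?thesis
    by (intro inv_equality simple_reflection_in_BijGroup)
qed

text \<open>
  The generators are involutions, so the inverses that occur in the generated group are generators again.
\<close>
lemma weyl_group_invariant:
  assumes w: "w \<in> carrier (weyl_group (cartan_matrix a b))"
    and inv: "\<And>i \<mu>. f (simple_reflection (cartan_matrix a b) i \<mu>) = f \<mu>"
  shows "f (w \<mu>) = f \<mu>"
proof -
  let ?R = "{simple_reflection (cartan_matrix a b) 1, simple_reflection (cartan_matrix a b) 2}"
  interpret group "BijGroup (UNIV :: weight set)"
    by (rule group_BijGroup)
  have R: "?R \<subseteq> carrier (BijGroup UNIV)"
    by (simp add: simple_reflection_in_BijGroup)
  have "w \<in> generate (BijGroup UNIV) ?R"
    using w by (simp add: weyl_group_def)
  then show ?thesis
  proof (induction arbitrary: \<mu>)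
    case one
    show ?case by (simp add: BijGroup_def)
  next
    case (incl h)
    then show ?case using inv by auto
  next
    case (inv h)
    then show ?case using assms(2) by (auto simp: inv_simple_reflection)
  next
    case (eng h1 h2)
    have "h1 \<in> carrier (BijGroup UNIV)" "h2 \<in> carrier (BijGroup UNIV)"
      using eng.hyps generate_in_carrier[OF R] by auto
    then show ?case
      using eng.IH by (simp add: BijGroup_def compose_def)
  qed
qed

lemma weyl_orbit_invariant:
  assumes "Orb \<in> weyl_orbits (cartan_matrix a b)" "\<mu> \<in> Orb" "\<nu> \<in> Orb"
    and "\<And>i \<mu>. f (simple_reflection (cartan_matrix a b) i \<mu>) = f \<mu>"
  shows "f \<mu> = f \<nu>"
  using assms(1-3) weyl_group_invariant[where f = f, OF _ assms(4)]
  by (auto simp: weyl_orbits_def orbits_def orbit_def)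

lemma weyl_orbit_nonempty:
  assumes "Orb \<in> weyl_orbits (cartan_matrix a b)"
  shows "Orb \<noteq> {}"
proof -
  interpret group "weyl_group (cartan_matrix a b)"
    by (rule group_weyl_group)
  show ?thesis
    using assms one_closed by (auto simp: weyl_orbits_def orbits_def orbit_def)
qed

lemma simple_reflection_in_weyl_orbit:
  assumes "Orb \<in> weyl_orbits (cartan_matrix a b)" "\<mu> \<in> Orb"
  shows "simple_reflection (cartan_matrix a b) i \<mu> \<in> Orb"
proof -
  let ?A = "cartan_matrix a b" and ?r = "simple_reflection (cartan_matrix a b) i"
  interpret W: group "weyl_group ?A"
    by (rule group_weyl_group)
  interpret B: group "BijGroup (UNIV :: weight set)"
    by (rule group_BijGroup)
  obtain \<nu> w where Orb: "Orb = {v \<nu> | v. v \<in> carrier (weyl_group ?A)}"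
    and w: "w \<in> carrier (weyl_group ?A)" "\<mu> = w \<nu>"
    using assms by (auto simp: weyl_orbits_def orbits_def orbit_def)
  have r: "?r \<in> carrier (weyl_group ?A)"
    using exhaust_2[of i] by (auto simp: weyl_group_def intro: generate.incl)
  have "w \<in> carrier (BijGroup UNIV)"
    using w(1) B.generate_in_carrier[of "{simple_reflection ?A 1, simple_reflection ?A 2}" w]
    by (simp add: weyl_group_def simple_reflection_in_BijGroup)
  then have "?r \<otimes>\<^bsub>weyl_group ?A\<^esub> w = ?r \<circ> w"
    using simple_reflection_in_BijGroup[of a b i]
    by (simp add: weyl_group_def BijGroup_def compose_def fun_eq_iff)
  then have "?r \<circ> w \<in> carrier (weyl_group ?A)"
    using W.m_closed[OF r w(1)] by simp
  then show ?thesis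
    unfolding Orb w(2) by (auto intro!: exI[of _ "?r \<circ> w"])
qed

lemma dominant_weights_iff: "\<mu> \<in> P\<^sup>+ \<longleftrightarrow> \<mu> $ 1 \<ge> 0 \<and> \<mu> $ 2 \<ge> 0"
proof -
  have "\<mu> = \<mu> $ 1 *s \<Lambda> 1 + \<mu> $ 2 *s \<Lambda> 2"
    by (simp add: vec_eq_iff forall_2 fundamental_weight_def axis_def)
  then show ?thesis
    unfolding dominant_weights_def
    by (auto simp: fundamental_weight_def axis_def)
qed

lemma antidominant_weights_iff: "\<mu> \<in> -P\<^sup>+ \<longleftrightarrow> \<mu> $ 1 \<le> 0 \<and> \<mu> $ 2 \<le> 0"
proof -
  have "\<mu> \<in> -P\<^sup>+ \<longleftrightarrow> - \<mu> \<in> P\<^sup>+"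
    unfolding antidominant_weights_def by (metis (no_types, lifting) image_iff minus_minus)
  then show ?thesis by (simp add: dominant_weights_iff)
qed

section \<open>The invariant quadratic form\<close>

definition weyl_form :: "int \<Rightarrow> int \<Rightarrow> weight \<Rightarrow> int" where
  "weyl_form a b \<mu> = b * (\<mu> $ 1)\<^sup>2 + a * b * (\<mu> $ 1 * \<mu> $ 2) + a * (\<mu> $ 2)\<^sup>2"

lemma weyl_form_simple_reflection:
  "weyl_form a b (simple_reflection (cartan_matrix a b) i \<mu>) = weyl_form a b \<mu>"
  using exhaust_2[of i]
  by (auto simp: weyl_form_def simple_reflection_coords power2_eq_square algebra_simps)

lemma weyl_form_nonneg:
  assumes "a \<ge> 0" "b \<ge> 0" "\<mu> \<in> P\<^sup>+ \<union> -P\<^sup>+"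
  shows "weyl_form a b \<mu> \<ge> 0"
proof -
  have "\<mu> $ 1 * \<mu> $ 2 \<ge> 0"
    using assms(3) by (auto simp: dominant_weights_iff antidominant_weights_iff mult_nonpos_nonpos)
  then show ?thesis
    using assms(1,2) by (simp add: weyl_form_def)
qed

lemma sum_less_prod:
  fixes a b :: int
  assumes "a \<ge> 2" "b \<ge> 2" "a * b > 4"
  shows "a + b < a * b"
proof (cases "a = 2")
  case True
  then show ?thesis using assms by simp
next
  case False
  then have "(a - 2) * (b - 2) \<ge> 0" "a \<ge> 3" using assms by auto
  moreover have "(a - 3) * (b - 2) \<ge> 0" using \<open>a \<ge> 3\<close> assms by auto
  ultimately show ?thesis using assms by (simp add: algebra_simps)
qed

text \<open>
  With \<open>t = k / l\<close> this is the convexity of \<open>b t\<^sup>2 - a b t + a\<close> between \<open>t = 1\<close> and \<open>t = a - 1\<close>, in the form of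
  the identity \<open>b t\<^sup>2 - a b t + a = b (t - 1) (t - (a - 1)) + (a + b - a b)\<close>.
\<close>
lemma form_neg_between:
  fixes a b k l :: int
  assumes "b \<ge> 0" "a + b < a * b" "l > 0" "l \<le> k" "k \<le> (a - 1) * l"
  shows "b * k\<^sup>2 - a * b * (k * l) + a * l\<^sup>2 < 0"
proof -
  have "b * k\<^sup>2 - a * b * (k * l) + a * l\<^sup>2
      = b * ((k - l) * (k - (a - 1) * l)) + (a + b - a * b) * l\<^sup>2"
    by (simp add: power2_eq_square algebra_simps)
  moreover have "b * ((k - l) * (k - (a - 1) * l)) \<le> 0"
    using assms by (intro mult_nonneg_nonpos) auto
  moreover have "(a + b - a * b) * l\<^sup>2 < 0"
    using assms by (intro mult_neg_pos) auto
  ultimately show ?thesis by linarith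
qed

lemma weyl_form_difference:
  "weyl_form a b (k *s \<Lambda> 1 - l *s \<Lambda> 2) = b * k\<^sup>2 - a * b * (k * l) + a * l\<^sup>2"
  by (simp add: weyl_form_def fundamental_weight_def axis_def)

section \<open>Orbits without dominant or antidominant weights\<close>

text \<open>
  Minimality of \<open>\<bar>x\<bar> + \<bar>y\<bar>\<close> against \<open>r\<^sub>2\<close> and \<open>r\<^sub>1\<close> respectively gives the two inequalities: the reflected weight
  also has coordinates of opposite signs, so that its absolute values are \<open>a l - k, l\<close> and \<open>k, b k - l\<close>.
\<close>
lemma minimal_weight:
  assumes Orb: "Orb \<in> weyl_orbits (cartan_matrix a b)"
    and avoid: "Orb \<inter> (P\<^sup>+ \<union> -P\<^sup>+) = {}"
  obtains k l where "k > 0" "l > 0" "2 * k \<le> a * l" "2 * l \<le> b * k"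
    "k *s \<Lambda> 1 - l *s \<Lambda> 2 \<in> Orb \<or> - k *s \<Lambda> 1 + l *s \<Lambda> 2 \<in> Orb"
proof -
  let ?h = "\<lambda>\<mu> :: weight. nat (\<bar>\<mu> $ 1\<bar> + \<bar>\<mu> $ 2\<bar>)"
  obtain \<mu> where \<mu>: "\<mu> \<in> Orb" and "\<forall>\<nu>. \<nu> \<in> Orb \<longrightarrow> ?h \<mu> \<le> ?h \<nu>"
    using weyl_orbit_nonempty[OF Orb] ex_has_least_nat[of "\<lambda>\<mu>. \<mu> \<in> Orb" _ ?h] by blast
  then have least: "\<bar>\<mu> $ 1\<bar> + \<bar>\<mu> $ 2\<bar> \<le> \<bar>\<nu> $ 1\<bar> + \<bar>\<nu> $ 2\<bar>" if "\<nu> \<in> Orb" for \<nu>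
    using that by (simp add: nat_le_eq_zle)
  have opp: "\<nu> $ 1 > 0 \<and> \<nu> $ 2 < 0 \<or> \<nu> $ 1 < 0 \<and> \<nu> $ 2 > 0" if "\<nu> \<in> Orb" for \<nu>
    using that avoid dominant_weights_iff[of \<nu>] antidominant_weights_iff[of \<nu>] by force
  note r = simple_reflection_in_weyl_orbit[OF Orb \<mu>]
  have "2 * \<bar>\<mu> $ 1\<bar> \<le> a * \<bar>\<mu> $ 2\<bar>"
    using opp[OF \<mu>] opp[OF r[of 2]] least[OF r[of 2]] by (auto simp: simple_reflection_coords)
  moreover have "2 * \<bar>\<mu> $ 2\<bar> \<le> b * \<bar>\<mu> $ 1\<bar>"
    using opp[OF \<mu>] opp[OF r[of 1]] least[OF r[of 1]] by (auto simp: simple_reflection_coords)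
  moreover have "\<mu> = \<bar>\<mu> $ 1\<bar> *s \<Lambda> 1 - \<bar>\<mu> $ 2\<bar> *s \<Lambda> 2 \<or> \<mu> = - \<bar>\<mu> $ 1\<bar> *s \<Lambda> 1 + \<bar>\<mu> $ 2\<bar> *s \<Lambda> 2"
    using opp[OF \<mu>] by (auto simp: vec_eq_iff forall_2 fundamental_weight_def axis_def)
  moreover have "\<bar>\<mu> $ 1\<bar> > 0" "\<bar>\<mu> $ 2\<bar> > 0"
    using opp[OF \<mu>] by auto
  ultimately show thesis
    using that[of "\<bar>\<mu> $ 1\<bar>" "\<bar>\<mu> $ 2\<bar>"] \<mu> by metis
qed

lemma reflect_negative_weight:
  "simple_reflection (cartan_matrix a b) 1 (- k *s \<Lambda> 1 + l *s \<Lambda> 2) = k *s \<Lambda> 1 - (b * k - l) *s \<Lambda> 2"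
  "simple_reflection (cartan_matrix a b) 2 (- k *s \<Lambda> 1 + l *s \<Lambda> 2) = (a * l - k) *s \<Lambda> 1 - l *s \<Lambda> 2"
  by (simp_all add: vec_eq_iff forall_2 simple_reflection_coords fundamental_weight_def axis_def)

theorem theorem1p1:
  fixes a b :: int and Orb :: "weight set"
  assumes "a \<ge> 2" and "b \<ge> 2" and "a * b > 4"
    and "Orb \<in> weyl_orbits (cartan_matrix a b)"
  shows "Orb \<inter> (P\<^sup>+ \<union> -P\<^sup>+) = {} \<longleftrightarrow>
    (\<exists>k l :: int. k > 0 \<and> l > 0 \<and> l \<le> k \<and> k < (a - 1) * l \<and> k *s \<Lambda> 1 - l *s \<Lambda> 2 \<in> Orb) \<or>
    (\<exists>k l :: int. k > 0 \<and> l > 0 \<and> k < l \<and> l \<le> (b - 1) * k \<and> k *s \<Lambda> 1 - l *s \<Lambda> 2 \<in> Orb)"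
    (is "?avoid \<longleftrightarrow> ?i \<or> ?ii")
proof
  assume ?avoid
  then obtain k l where kl: "k > 0" "l > 0" "2 * k \<le> a * l" "2 * l \<le> b * k"
    and sign: "k *s \<Lambda> 1 - l *s \<Lambda> 2 \<in> Orb \<or> - k *s \<Lambda> 1 + l *s \<Lambda> 2 \<in> Orb"
    using minimal_weight[OF assms(4)] by metis
  have al: "2 * l \<le> a * l" and bk: "2 * k \<le> b * k"
    using assms kl by simp_all
  have i: ?i if "l \<le> k'" "k' < (a - 1) * l" "k' *s \<Lambda> 1 - l *s \<Lambda> 2 \<in> Orb" for k'
    using that kl(2) by (intro exI[of _ k'] exI[of _ l]) auto
  have ii: ?ii if "k < l'" "l' \<le> (b - 1) * k" "k *s \<Lambda> 1 - l' *s \<Lambda> 2 \<in> Orb" for l'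
    using that kl(1) by (intro exI[of _ k] exI[of _ l']) auto
  show "?i \<or> ?ii"
  proof (cases "- k *s \<Lambda> 1 + l *s \<Lambda> 2 \<in> Orb")
    case True
    from simple_reflection_in_weyl_orbit[OF assms(4) True]
    have r1: "k *s \<Lambda> 1 - (b * k - l) *s \<Lambda> 2 \<in> Orb" and r2: "(a * l - k) *s \<Lambda> 1 - l *s \<Lambda> 2 \<in> Orb"
      by (metis reflect_negative_weight(1), metis reflect_negative_weight(2))
    consider "l < k" | "k \<le> l" "k < b * k - l" | "k \<le> l" "b * k - l \<le> k" by linarith
    then show ?thesis
    proof cases
      case 1
      then show ?thesis using i[OF _ _ r2] kl al by (simp add: algebra_simps)
    next
      case 2
      then show ?thesis using ii[OF _ _ r1] by (simp add: algebra_simps)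
    next
      \<comment> \<open>This forces \<open>b = 2\<close> and \<open>k = l\<close>, so that \<open>r\<^sub>1\<close> yields \<open>k \<Lambda>\<^sub>1 - k \<Lambda>\<^sub>2\<close>; since \<open>a > 2\<close>, it has form (i).\<close>
      case 3
      then have "b * k = 2 * k" "k = l" using kl bk by linarith+
      then have "b = 2" using kl by simp
      then have "3 * l \<le> a * l" using assms(3) kl by simp
      then show ?thesis
        using i[of k] r1 kl \<open>b * k = 2 * k\<close> \<open>k = l\<close> by (simp add: algebra_simps)
    qed
  next
    case False
    then have pos: "k *s \<Lambda> 1 - l *s \<Lambda> 2 \<in> Orb" using sign by blast
    consider "k < l" | "l \<le> k" "k < (a - 1) * l" | "l \<le> k" "(a - 1) * l \<le> k" by linarith
    then show ?thesis
    proof cases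
      case 1
      then show ?thesis using ii[OF _ _ pos] kl bk by (simp add: algebra_simps)
    next
      case 2
      then show ?thesis using i[OF _ _ pos] by simp
    next
      \<comment> \<open>This forces \<open>a = 2\<close> and \<open>k = l\<close>, and then \<open>r\<^sub>2\<close> maps the weight to its negative, which was treated above.\<close>
      case 3
      then have "a * l \<le> k + l" by (simp add: algebra_simps)
      then have "a * l = 2 * l" "k = l" using 3 kl al by linarith+
      then have "simple_reflection (cartan_matrix a b) 2 (k *s \<Lambda> 1 - l *s \<Lambda> 2)
          = - k *s \<Lambda> 1 + l *s \<Lambda> 2"
        by (simp add: vec_eq_iff forall_2 simple_reflection_coords fundamental_weight_def axis_def)
      then show ?thesis
        using simple_reflection_in_weyl_orbit[OF assms(4) pos, of 2] False by simp
    qed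
  qed
next
  assume "?i \<or> ?ii"
  then obtain k l where mem: "k *s \<Lambda> 1 - l *s \<Lambda> 2 \<in> Orb" and kl: "k > 0" "l > 0"
    "l \<le> k \<and> k \<le> (a - 1) * l \<or> k \<le> l \<and> l \<le> (b - 1) * k"
    using less_imp_le by metis
  have "b * k\<^sup>2 - a * b * (k * l) + a * l\<^sup>2 < 0"
    using kl(3)
  proof
    assume "l \<le> k \<and> k \<le> (a - 1) * l"
    then show ?thesis
      using form_neg_between[of b a l k] sum_less_prod[of a b] assms kl by simp
  next
    assume "k \<le> l \<and> l \<le> (b - 1) * k"
    then show ?thesis
      using form_neg_between[of a b k l] sum_less_prod[of a b] assms kl
      by (simp add: algebra_simps)
  qed
  then have neg: "weyl_form a b (k *s \<Lambda> 1 - l *s \<Lambda> 2) < 0"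
    by (simp add: weyl_form_difference)
  show ?avoid
  proof (rule ccontr)
    assume "\<not> ?avoid"
    then obtain \<mu> where \<mu>: "\<mu> \<in> Orb" "\<mu> \<in> P\<^sup>+ \<union> -P\<^sup>+" by blast
    have "weyl_form a b (k *s \<Lambda> 1 - l *s \<Lambda> 2) = weyl_form a b \<mu>"
      using weyl_orbit_invariant[OF assms(4) mem \<mu>(1)] weyl_form_simple_reflection by blast
    then show False
      using neg weyl_form_nonneg[OF _ _ \<mu>(2), of a b] assms by simp
  qed
qed

end
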